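(* Let $\mathcal H$ be a real Hilbert space, let $A_1,A_2:\mathcal H\to2^{\mathcal H}$ be maximal monotone, and let $\lambda_1,\lambda_2>0$ with $\lambda_1+\lambda_2=1$. Let $E:=\operatorname{Fix}(J_{A_1/\lambda_2}J_{A_2/\lambda_1})$, $F:=\operatorname{Fix}(J_{A_2/\lambda_1}J_{A_1/\lambda_2})$ and $S:=\{(x,y)\in\mathcal H\times\mathcal H: x=J_{A_1/\lambda_2}y,\ y=J_{A_2/\lambda_1}x\}$. Then: (i) The mapping $T_1:E\to S: x\mapsto(x,J_{A_2/\lambda_1}x)$ is a homeomorphism and its inverse is $T_1^{-1}:S\to E:(x,y)\mapsto x$. (ii) The mapping $T_2:F\to S: y\mapsto(J_{A_1/\lambda_2}y,y)$ is a homeomorphism and its inverse is $T_2^{-1}:S\to F:(x,y)\mapsto y$.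
   Context: For a maximal monotone operator $B:\mathcal H\to2^{\mathcal H}$, the resolvent $J_B:=(B+\operatorname{Id})^{-1}$ is single-valued with full domain and regarded as a map $\mathcal H\to\mathcal H$. $B/\lambda$ denotes $x\mapsto\{u/\lambda:u\in Bx\}$. $\operatorname{Fix}T:=\{x:Tx=x\}$. A homeomorphism is a continuous bijection with continuous inverse (norm topologies). *)

theory Defs
  imports "HOL-Analysis.Analysis"
begin

text \<open>A set-valued operator \<open>A : \<H> \<rightarrow> 2\<^sup>\<H>\<close> is a function \<open>'h \<Rightarrow> 'h set\<close>; a real Hilbert space
  is a type of class \<open>{real_inner, complete_space}\<close>.\<close>

definition graph_of :: "('h \<Rightarrow> 'h set) \<Rightarrow> ('h \<times> 'h) set" where
  "graph_of A = {(x, u). u \<in> A x}"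

definition monotone_operator :: "('h::real_inner \<Rightarrow> 'h set) \<Rightarrow> bool" where
  "monotone_operator A \<longleftrightarrow>
     (\<forall>(x, u) \<in> graph_of A. \<forall>(y, v) \<in> graph_of A. 0 \<le> (x - y) \<bullet> (u - v))"

definition maximal_monotone :: "('h::real_inner \<Rightarrow> 'h set) \<Rightarrow> bool" where
  "maximal_monotone A \<longleftrightarrow>
     monotone_operator A \<and> (\<nexists>B. monotone_operator B \<and> graph_of A \<subset> graph_of B)"

definition op_plus_id :: "('h::real_inner \<Rightarrow> 'h set) \<Rightarrow> 'h \<Rightarrow> 'h set" where
  "op_plus_id B = (\<lambda>x. (\<lambda>u. u + x) ` B x)"

definition op_inverse :: "('h \<Rightarrow> 'h set) \<Rightarrow> 'h \<Rightarrow> 'h set" where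
  "op_inverse B = (\<lambda>u. {x. u \<in> B x})"

definition op_divide :: "('h::real_inner \<Rightarrow> 'h set) \<Rightarrow> real \<Rightarrow> 'h \<Rightarrow> 'h set" where
  "op_divide B c = (\<lambda>x. (\<lambda>u. u /\<^sub>R c) ` B x)"

text \<open>The resolvent \<open>(B + Id)\<^sup>-\<^sup>1\<close> regarded as a map: its value at \<open>x\<close> is the unique element of the
  set \<open>(B + Id)\<^sup>-\<^sup>1 x\<close>. That this set is a singleton for every \<open>x\<close> when \<open>B\<close> is maximal monotone
  is Minty's theorem, which the definition does not presuppose; for other \<open>B\<close> the value may be
  unspecified.\<close>

definition resolvent :: "('h::real_inner \<Rightarrow> 'h set) \<Rightarrow> 'h \<Rightarrow> 'h" where
  "resolvent B = (\<lambda>x. THE y. y \<in> op_inverse (op_plus_id B) x)"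

definition Fix :: "('h \<Rightarrow> 'h) \<Rightarrow> 'h set" where
  "Fix T = {x. T x = x}"

end

theory Submission
  imports Defs
begin

text \<open>
  The maps \<open>x \<mapsto> (x, J2 x)\<close> and \<open>y \<mapsto> (J1 y, y)\<close> parametrise the solution set \<open>S\<close> by the fixed
  points of the two compositions, and the coordinate projections undo them; this is pure
  bookkeeping about two arbitrary maps, and the topology only needs \<open>J1\<close> and \<open>J2\<close> to be continuous
  (\<open>homeomorphism_fixpoints_graph\<close>).  The substance of the theorem is therefore that the resolvent of a
  maximal monotone operator is a continuous map on the whole space.  Monotonicity makes it
  single-valued and nonexpansive where it is defined; that it is defined everywhere is Minty's theorem.

  Minty's theorem is proved here by a duality argument that uses completeness but no weak topology and
  no fixed point theorem.  By maximality, solving \<open>0 \<in> A x + x\<close> means finding \<open>x\<close> such that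
  \<open>(x, -x)\<close> is monotonically related to every \<open>(y, v)\<close> in the graph.  Expanding the inner product,
  this asks for a point in the intersection of the closed balls with centre \<open>c = (y - v)/2\<close> and
  squared radius \<open>c \<bullet> c - a\<close>, where \<open>a = - (y \<bullet> v)\<close>.  The dual problem is to maximise the concave
  function \<open>a - c \<bullet> c\<close> over the convex hull of all these pairs \<open>(c, a)\<close>.  Monotonicity says exactly that
  this function is nonpositive on the hull (\<open>convex_hull_monotone_nonneg\<close>).  The centres of a maximising
  sequence form a Cauchy sequence because the function is strongly concave in \<open>c\<close>, and the first-order
  condition at their limit says that the limit lies in all the balls (\<open>ball_family_intersection\<close>).
\<close>

section \<open>A common point of a convex family of balls\<close>

text \<open>The defect of concavity of the dual function is known exactly; it drives both the Cauchy estimate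
  and the first-order condition.\<close>

lemma dual_value_convex_combination:
  fixes c d :: "'h::real_inner" and a b t :: real
  shows "((1 - t) * a + t * b) - ((1 - t) *\<^sub>R c + t *\<^sub>R d) \<bullet> ((1 - t) *\<^sub>R c + t *\<^sub>R d)
       = (1 - t) * (a - c \<bullet> c) + t * (b - d \<bullet> d) + t * (1 - t) * (norm (c - d))\<^sup>2"
  by (simp add: power2_norm_eq_inner inner_simps inner_commute algebra_simps)

text \<open>The inequality in the conclusion says \<open>(norm (x - c))\<^sup>2 \<le> c \<bullet> c - a\<close>.  The point \<open>x\<close> is the limit
  of the centres along a sequence maximising \<open>a - c \<bullet> c\<close> over \<open>Q\<close>.\<close>

lemma ball_family_intersection:
  fixes Q :: "('h::{real_inner, complete_space} \<times> real) set"
  assumes "convex Q" and nonpos: "\<And>c a. (c, a) \<in> Q \<Longrightarrow> a \<le> c \<bullet> c"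
  obtains x where "\<And>c a. (c, a) \<in> Q \<Longrightarrow> x \<bullet> x - 2 * (x \<bullet> c) + a \<le> 0"
proof (cases "Q = {}")
  case True
  then show thesis using that by blast
next
  case False
  define \<phi> where "\<phi> p = snd p - fst p \<bullet> fst p" for p :: "'h \<times> real"
  define M where "M = (SUP p\<in>Q. \<phi> p)"
  have bdd: "bdd_above (\<phi> ` Q)"
    using nonpos by (intro bdd_aboveI[of _ 0]) (auto simp: \<phi>_def)
  have upper: "\<phi> p \<le> M" if "p \<in> Q" for p
    unfolding M_def using bdd that by (rule cSUP_upper2) simp
  have "M \<le> 0"
    unfolding M_def using False nonpos by (intro cSUP_least) (auto simp: \<phi>_def)
  have segment: "(1 - t) * \<phi> p + t * \<phi> q + t * (1 - t) * (norm (fst p - fst q))\<^sup>2 \<le> M"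
    if "p \<in> Q" "q \<in> Q" "0 \<le> t" "t \<le> 1" for p q t
  proof -
    have "(1 - t) *\<^sub>R p + t *\<^sub>R q \<in> Q"
      using \<open>convex Q\<close> that by (simp add: convex_alt)
    from upper[OF this] show ?thesis
      unfolding \<phi>_def by (simp add: dual_value_convex_combination)
  qed
  have "\<exists>p\<in>Q. M - inverse (real (Suc n)) < \<phi> p" for n
    using less_cSUP_iff[OF False bdd, of "M - inverse (real (Suc n))"] by (simp add: M_def)
  then obtain P where P: "\<And>n. P n \<in> Q" "\<And>n. M - inverse (real (Suc n)) < \<phi> (P n)"
    by metis
  have \<phi>P: "(\<lambda>n. \<phi> (P n)) \<longlonglongrightarrow> M"
  proof (rule tendsto_sandwich)
    show "(\<lambda>n. M - inverse (real (Suc n))) \<longlonglongrightarrow> M"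
      using tendsto_diff[OF tendsto_const LIMSEQ_inverse_real_of_nat, of M] by simp
    show "(\<lambda>n. M) \<longlonglongrightarrow> M" by simp
  qed (use P upper in \<open>auto intro!: always_eventually less_imp_le\<close>)
  have "Cauchy (\<lambda>n. fst (P n))"
  proof (rule metric_CauchyI)
    fix e :: real assume "0 < e"
    then have "eventually (\<lambda>n. M - e\<^sup>2 / 4 < \<phi> (P n)) sequentially"
      using \<phi>P by (intro order_tendstoD(1)) auto
    then obtain N where N: "\<And>n. n \<ge> N \<Longrightarrow> M - e\<^sup>2 / 4 < \<phi> (P n)"
      by (auto simp: eventually_sequentially)
    have "dist (fst (P m)) (fst (P n)) < e" if "m \<ge> N" "n \<ge> N" for m n
    proof -
      have "(norm (fst (P m) - fst (P n)))\<^sup>2 < e\<^sup>2"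
        using segment[OF P(1) P(1), of "1/2" m n] N[OF that(1)] N[OF that(2)] by simp
      then show ?thesis
        using \<open>0 < e\<close> by (simp add: dist_norm power_less_imp_less_base)
    qed
    then show "\<exists>N. \<forall>m\<ge>N. \<forall>n\<ge>N. dist (fst (P m)) (fst (P n)) < e" by blast
  qed
  then obtain x where x: "(\<lambda>n. fst (P n)) \<longlonglongrightarrow> x"
    by (auto simp: Cauchy_convergent_iff convergent_def)
  show thesis
  proof (rule that)
    fix c a assume ca: "(c, a) \<in> Q"
    \<comment> \<open>First-order condition: move from the maximiser a fraction \<open>t\<close> towards \<open>(c, a)\<close>.\<close>
    have step: "\<phi> (c, a) + (1 - t) * (norm (x - c))\<^sup>2 \<le> M" if t: "0 < t" "t \<le> 1" for t
    proof -
      have "(\<lambda>n. (1 - t) * \<phi> (P n) + t * \<phi> (c, a) + t * (1 - t) * (norm (fst (P n) - c))\<^sup>2)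
              \<longlonglongrightarrow> (1 - t) * M + t * \<phi> (c, a) + t * (1 - t) * (norm (x - c))\<^sup>2"
        by (intro tendsto_intros \<phi>P x)
      then have "(1 - t) * M + t * \<phi> (c, a) + t * (1 - t) * (norm (x - c))\<^sup>2 \<le> M"
        using segment[OF P(1) ca, of t] t by (intro LIMSEQ_le_const2) auto
      then have "t * (\<phi> (c, a) + (1 - t) * (norm (x - c))\<^sup>2) \<le> t * M"
        by (simp add: algebra_simps)
      then show ?thesis using t by simp
    qed
    have "((\<lambda>t. \<phi> (c, a) + (1 - t) * (norm (x - c))\<^sup>2)
             \<longlongrightarrow> \<phi> (c, a) + (1 - 0) * (norm (x - c))\<^sup>2) (at_right 0)"
      by (intro tendsto_intros)
    moreover have "eventually (\<lambda>t. \<phi> (c, a) + (1 - t) * (norm (x - c))\<^sup>2 \<le> M) (at_right 0)"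
      using step by (auto simp: eventually_at_right_field intro!: exI[of _ 1])
    ultimately have "\<phi> (c, a) + (norm (x - c))\<^sup>2 \<le> M"
      using tendsto_upperbound[of _ _ "at_right (0::real)"] by fastforce
    with \<open>M \<le> 0\<close> show "x \<bullet> x - 2 * (x \<bullet> c) + a \<le> 0"
      by (simp add: \<phi>_def power2_norm_eq_inner inner_simps inner_commute)
  qed
qed

section \<open>Minty's theorem\<close>

text \<open>Monotonicity is a statement about pairs of graph points; on the convex hull it becomes Jensen's
  inequality for the duality pairing.  The inequality \<open>s - y \<bullet> v' - y' \<bullet> v + s' \<ge> 0\<close> is affine in each
  of the two points separately, so it extends from graph points to the hull one argument at a time;
  then both arguments are taken equal.\<close>

lemma convex_hull_monotone_nonneg:
  fixes G :: "('h::real_inner \<times> 'h) set"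
  assumes mono: "\<And>y v y' v'. (y, v) \<in> G \<Longrightarrow> (y', v') \<in> G \<Longrightarrow> 0 \<le> (y - y') \<bullet> (v - v')"
    and mem: "(y, v, s) \<in> convex hull ((\<lambda>(y, v). (y, v, y \<bullet> v)) ` G)"
  shows "y \<bullet> v \<le> s"
proof -
  define K where "K = (\<lambda>(y, v). (y, v, y \<bullet> v)) ` G"
  define H where "H y' v' s' = {(y, v, s). y \<bullet> v' + y' \<bullet> v \<le> s + s'}" for y' v' :: 'h and s' :: real
  have convex_H: "convex (H y' v' s')" for y' v' s'
  proof (rule convexI; clarsimp simp: H_def inner_simps)
    fix y v y2 v2 :: 'h and s s2 p q :: real
    assume h: "y \<bullet> v' + y' \<bullet> v \<le> s + s'" "y2 \<bullet> v' + y' \<bullet> v2 \<le> s2 + s'"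
      and pq: "0 \<le> p" "0 \<le> q" "p + q = 1"
    have "p * (y \<bullet> v' + y' \<bullet> v) + q * (y2 \<bullet> v' + y' \<bullet> v2) \<le> p * (s + s') + q * (s2 + s')"
      by (intro add_mono mult_left_mono h pq)
    moreover have "p * (s + s') + q * (s2 + s') = p * s + q * s2 + (p + q) * s'"
      by (simp add: algebra_simps)
    ultimately show "p * (y \<bullet> v') + q * (y2 \<bullet> v') + (p * (y' \<bullet> v) + q * (y' \<bullet> v2)) \<le> p * s + q * s2 + s'"
      using pq(3) by (simp add: algebra_simps)
  qed
  have "K \<subseteq> H y' v' (y' \<bullet> v')" if "(y', v') \<in> G" for y' v'
    using mono[OF _ that] by (auto simp: K_def H_def inner_simps algebra_simps)
  then have one: "convex hull K \<subseteq> H y' v' (y' \<bullet> v')" if "(y', v') \<in> G" for y' v'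
    using that by (intro hull_minimal convex_H)
  have mem': "(y, v, s) \<in> convex hull K"
    using mem by (simp add: K_def)
  have "K \<subseteq> H y v s"
    using one mem' by (fastforce simp: K_def H_def inner_commute)
  then have "convex hull K \<subseteq> H y v s"
    using convex_H by (rule hull_minimal)
  with mem' show ?thesis by (auto simp: H_def)
qed

text \<open>With \<open>c = (y - v)/2\<close> and \<open>a = - (y \<bullet> v)\<close> the required inequality is membership in a ball of the
  family above.  The family is made convex by taking \<open>a = - s\<close> for \<open>(y, v, s)\<close> in the hull; then
  \<open>a \<le> c \<bullet> c\<close> because \<open>s \<ge> y \<bullet> v\<close> there and \<open>c \<bullet> c + y \<bullet> v\<close> is a quarter of \<open>(norm (y + v))\<^sup>2\<close>.\<close>

lemma monotonically_related_point:
  fixes G :: "('h::{real_inner, complete_space} \<times> 'h) set"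
  assumes mono: "\<And>y v y' v'. (y, v) \<in> G \<Longrightarrow> (y', v') \<in> G \<Longrightarrow> 0 \<le> (y - y') \<bullet> (v - v')"
  obtains x where "\<And>y v. (y, v) \<in> G \<Longrightarrow> 0 \<le> (x - y) \<bullet> (- x - v)"
proof -
  define K where "K = (\<lambda>(y, v). (y, v, y \<bullet> v)) ` G"
  define L :: "'h \<times> 'h \<times> real \<Rightarrow> 'h \<times> real"
    where "L = (\<lambda>(y, v, s). ((1/2) *\<^sub>R (y - v), - s))"
  have "linear L"
    by (rule linearI) (auto simp: L_def algebra_simps)
  then have "convex (L ` (convex hull K))"
    by (simp add: convex_linear_image)
  moreover have "a \<le> c \<bullet> c" if ca: "(c, a) \<in> L ` (convex hull K)" for c a
  proof -
    obtain y v s where yvs: "(y, v, s) \<in> convex hull K" "c = (1/2) *\<^sub>R (y - v)" "a = - s"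
      using ca by (auto simp: L_def)
    have "y \<bullet> v \<le> s"
      using convex_hull_monotone_nonneg[OF mono] yvs(1) unfolding K_def by blast
    moreover have "0 \<le> (y + v) \<bullet> (y + v)" by simp
    ultimately show ?thesis
      by (simp add: yvs inner_simps inner_commute field_simps)
  qed
  ultimately obtain x where
    x: "\<And>c a. (c, a) \<in> L ` (convex hull K) \<Longrightarrow> x \<bullet> x - 2 * (x \<bullet> c) + a \<le> 0"
    using ball_family_intersection by blast
  show thesis
  proof (rule that)
    fix y v assume "(y, v) \<in> G"
    then have "(y, v, y \<bullet> v) \<in> convex hull K"
      by (intro hull_inc) (auto simp: K_def)
    then have "((1/2) *\<^sub>R (y - v), - (y \<bullet> v)) \<in> L ` (convex hull K)"
      by (force simp: L_def)
    from x[OF this] show "0 \<le> (x - y) \<bullet> (- x - v)"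
      by (simp add: inner_simps inner_commute algebra_simps)
  qed
qed

text \<open>Maximality in usable form: a pair monotonically related to the whole graph could be adjoined to
  it, hence already belongs to it.\<close>

lemma maximal_monotone_iff:
  "maximal_monotone A \<longleftrightarrow> monotone_operator A \<and>
     (\<forall>x u. (\<forall>y. \<forall>v\<in>A y. 0 \<le> (x - y) \<bullet> (u - v)) \<longrightarrow> u \<in> A x)"
  (is "_ \<longleftrightarrow> _ \<and> ?closed")
proof (intro iffI conjI)
  assume max: "maximal_monotone A"
  then show mono: "monotone_operator A" by (simp add: maximal_monotone_def)
  show ?closed
  proof (intro allI impI)
    fix x u assume rel: "\<forall>y. \<forall>v\<in>A y. 0 \<le> (x - y) \<bullet> (u - v)"
    define B where "B = A(x := insert u (A x))"
    have gB: "graph_of B = insert (x, u) (graph_of A)"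
      by (auto simp: graph_of_def B_def split: if_splits)
    have rel': "0 \<le> (y - x) \<bullet> (v - u)" if "v \<in> A y" for y v
      using rel that by (metis inner_minus_left inner_minus_right minus_diff_eq minus_minus)
    have "monotone_operator B"
      using mono rel rel' unfolding monotone_operator_def gB by (auto simp: graph_of_def)
    with max have "\<not> graph_of A \<subset> graph_of B"
      by (auto simp: maximal_monotone_def)
    then have "(x, u) \<in> graph_of A"
      unfolding gB by blast
    then show "u \<in> A x"
      by (simp add: graph_of_def)
  qed
next
  assume asm: "monotone_operator A \<and> ?closed"
  have "graph_of B \<subseteq> graph_of A" if B: "monotone_operator B" "graph_of A \<subset> graph_of B" for B
    using asm B unfolding monotone_operator_def graph_of_def by fast
  with asm show "maximal_monotone A"
    unfolding maximal_monotone_def by blast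
qed

lemma maximal_monotone_op_divide:
  assumes max: "maximal_monotone A" and "c > 0"
  shows "maximal_monotone (op_divide A c)"
  unfolding maximal_monotone_iff
proof (intro conjI allI impI)
  have mono: "0 \<le> (x - y) \<bullet> (u - v)" if "u \<in> A x" "v \<in> A y" for x y u v
    using max that by (auto simp: maximal_monotone_def monotone_operator_def graph_of_def)
  have scale: "(x - y) \<bullet> (u /\<^sub>R c - v /\<^sub>R c) = (x - y) \<bullet> (u - v) / c" for x y u v :: 'a
    by (simp add: inner_simps divide_inverse algebra_simps)
  show "monotone_operator (op_divide A c)"
    using mono \<open>c > 0\<close>
    by (auto simp: monotone_operator_def graph_of_def op_divide_def scale)
  fix x u assume rel: "\<forall>y. \<forall>v\<in>op_divide A c y. 0 \<le> (x - y) \<bullet> (u - v)"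
  have u: "u = (c *\<^sub>R u) /\<^sub>R c" using \<open>c > 0\<close> by simp
  have "0 \<le> (x - y) \<bullet> (c *\<^sub>R u - v)" if "v \<in> A y" for y v
  proof -
    have "0 \<le> (x - y) \<bullet> ((c *\<^sub>R u) /\<^sub>R c - v /\<^sub>R c)"
      using rel that u by (auto simp: op_divide_def)
    then show ?thesis
      unfolding scale using \<open>c > 0\<close> by (simp add: zero_le_divide_iff)
  qed
  then have "c *\<^sub>R u \<in> A x" using max by (simp add: maximal_monotone_iff)
  then show "u \<in> op_divide A c x"
    using u unfolding op_divide_def by blast
qed

lemma mem_op_inverse_op_plus_id:
  "x \<in> op_inverse (op_plus_id B) z \<longleftrightarrow> z - x \<in> B x"
proof -
  have "z \<in> (\<lambda>u. u + x) ` B x \<longleftrightarrow> z - x \<in> B x"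
    by (metis (no_types, lifting) add_diff_cancel_right' diff_add_cancel image_iff)
  then show ?thesis by (simp add: op_inverse_def op_plus_id_def)
qed

text \<open>Shifting the values of \<open>B\<close> by \<open>z\<close> keeps monotonicity and reduces the inclusion
  \<open>z \<in> B x + x\<close> to the case of right-hand side 0 treated above.\<close>

theorem Minty:
  fixes B :: "'h::{real_inner, complete_space} \<Rightarrow> 'h set"
  assumes max: "maximal_monotone B"
  shows "\<exists>x. z - x \<in> B x"
proof -
  define G where "G = {(y, v - z) | y v. v \<in> B y}"
  have "0 \<le> (y - y') \<bullet> (v - v')" if "(y, v) \<in> G" "(y', v') \<in> G" for y v y' v'
    using max that
    by (fastforce simp: G_def maximal_monotone_def monotone_operator_def graph_of_def)
  then obtain x where x: "\<And>y v. (y, v) \<in> G \<Longrightarrow> 0 \<le> (x - y) \<bullet> (- x - v)"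
    using monotonically_related_point by blast
  have "0 \<le> (x - y) \<bullet> (z - x - v)" if "v \<in> B y" for y v
    using x[of y "v - z"] that by (auto simp: G_def algebra_simps)
  then have "z - x \<in> B x" using max by (simp add: maximal_monotone_iff)
  then show ?thesis by blast
qed

section \<open>Continuity of the resolvent and the homeomorphisms\<close>

lemma monotone_operator_inverse_nonexpansive:
  assumes mono: "monotone_operator B" and x: "z - x \<in> B x" and y: "w - y \<in> B y"
  shows "norm (x - y) \<le> norm (z - w)"
proof -
  have "0 \<le> (x - y) \<bullet> ((z - x) - (w - y))"
    using mono x y by (auto simp: monotone_operator_def graph_of_def)
  then have "(norm (x - y))\<^sup>2 \<le> (x - y) \<bullet> (z - w)"
    by (simp add: power2_norm_eq_inner inner_simps inner_commute)
  also have "\<dots> \<le> norm (x - y) * norm (z - w)"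
    by (rule norm_cauchy_schwarz)
  finally show ?thesis
    by (cases "x = y") (simp_all add: power2_eq_square)
qed

lemma resolvent_mem:
  fixes B :: "'h::{real_inner, complete_space} \<Rightarrow> 'h set"
  assumes "maximal_monotone B"
  shows "z - resolvent B z \<in> B (resolvent B z)"
proof -
  have mono: "monotone_operator B" using assms by (simp add: maximal_monotone_def)
  obtain x where x: "z - x \<in> B x" using Minty[OF assms] by blast
  have "y = x" if "z - y \<in> B y" for y
    using monotone_operator_inverse_nonexpansive[OF mono that x] by simp
  then have "resolvent B z = x"
    unfolding resolvent_def mem_op_inverse_op_plus_id using x by blast
  with x show ?thesis by simp
qed

lemma continuous_on_resolvent:
  fixes B :: "'h::{real_inner, complete_space} \<Rightarrow> 'h set"
  assumes "maximal_monotone B"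
  shows "continuous_on X (resolvent B)"
proof -
  have "dist (resolvent B z) (resolvent B w) \<le> dist z w" for z w
    unfolding dist_norm using assms
    by (intro monotone_operator_inverse_nonexpansive[of B] resolvent_mem)
      (auto simp: maximal_monotone_def)
  then show ?thesis
    unfolding continuous_on_iff by (meson le_less_trans)
qed

lemma homeomorphism_fixpoints_graph:
  fixes f g :: "'h::topological_space \<Rightarrow> 'h"
  assumes "continuous_on UNIV g"
  shows "homeomorphism (Fix (f \<circ> g)) {(x, y). x = f y \<and> y = g x} (\<lambda>x. (x, g x)) (\<lambda>(x, y). x)"
proof (rule homeomorphismI)
  show "continuous_on (Fix (f \<circ> g)) (\<lambda>x. (x, g x))"
    using continuous_on_subset[OF assms] by (intro continuous_intros) auto
  show "continuous_on {(x, y). x = f y \<and> y = g x} (\<lambda>(x, y). x)"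
    unfolding case_prod_unfold by (intro continuous_intros)
qed (auto simp: Fix_def)

text \<open>The second homeomorphism is the first one for the exchanged pair of resolvents, followed by the
  swap of coordinates.\<close>

theorem theorem3p7:
  fixes A1 A2 :: "'h::{real_inner, complete_space} \<Rightarrow> 'h set"
    and l1 l2 :: real
    and J1 J2 :: "'h \<Rightarrow> 'h"
    and E F :: "'h set"
    and S :: "('h \<times> 'h) set"
  assumes "maximal_monotone A1" and "maximal_monotone A2"
    and "l1 > 0" and "l2 > 0" and "l1 + l2 = 1"
    and "J1 = resolvent (op_divide A1 l2)"
    and "J2 = resolvent (op_divide A2 l1)"
    and "E = Fix (J1 \<circ> J2)"
    and "F = Fix (J2 \<circ> J1)"
    and "S = {(x, y). x = J1 y \<and> y = J2 x}"
  shows "homeomorphism E S (\<lambda>x. (x, J2 x)) (\<lambda>(x, y). x) \<and>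
         homeomorphism F S (\<lambda>y. (J1 y, y)) (\<lambda>(x, y). y)"
proof
  have cont: "continuous_on UNIV J1" "continuous_on UNIV J2"
    using assms by (auto intro!: continuous_on_resolvent maximal_monotone_op_divide)
  show "homeomorphism E S (\<lambda>x. (x, J2 x)) (\<lambda>(x, y). x)"
    using homeomorphism_fixpoints_graph[OF cont(2)] assms by simp
  have "homeomorphism F {(y, x). y = J2 x \<and> x = J1 y} (\<lambda>y. (y, J1 y)) (\<lambda>(y, x). y)"
    using homeomorphism_fixpoints_graph[OF cont(1)] assms by simp
  moreover have "homeomorphism {(y, x). y = J2 x \<and> x = J1 y} S prod.swap prod.swap"
    using assms(10) by (intro homeomorphismI) (auto intro: continuous_on_swap)
  ultimately have "homeomorphism F S (prod.swap \<circ> (\<lambda>y. (y, J1 y))) ((\<lambda>(y, x). y) \<circ> prod.swap)"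
    by (rule homeomorphism_compose)
  moreover have "(\<lambda>(y, x). y) \<circ> prod.swap = (\<lambda>(x :: 'h, y :: 'h). y)"
    by auto
  ultimately show "homeomorphism F S (\<lambda>y. (J1 y, y)) (\<lambda>(x, y). y)"
    by (simp add: o_def)
qed

end
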